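(* Let $(X,\rho)$ be an Hadamard space, $A\colon X\to 2^{TX}$ a monotone vector field satisfying the surjectivity condition, $J_\lambda$ the resolvent of $A$ with respect to $\lambda>0$, and $\{x_n\}$ a sequence defined by $x_1\in X$ and $$x_{n+1}=J_{\lambda_n}x_n\quad(n=1,2,\dots),$$ where $\{\lambda_n\}$ is a sequence of positive real numbers. Then the following hold. (i) If $\sum_{n=1}^{\infty}\lambda_n=\infty$, then $\{x_n\}$ is bounded if and only if $\mathcal{Z}(A)$ is nonempty. (ii) If $\mathcal{Z}(A)$ is nonempty and $\sum_{n=1}^{\infty}\lambda_n^2=\infty$, then $\{x_n\}$ is $\Delta$-convergent to a point in $\mathcal{Z}(A)$.
   Context: Geodesics and CAT(0) spaces. In a metric space $(X,\rho)$, a geodesic from $p$ to $q$ is a map $\gamma\colon[0,\rho(p,q)]\to X$ with $\gamma(0)=p$, $\gamma(\rho(p,q))=q$ and $\rho(\gamma(s),\gamma(t))=|s-t|$ for all $s,t$. $X$ is uniquely geodesic if for all $p,q\in X$ there is exactly one geodesic from $p$ to $q$, denoted $\gamma_{p,q}$; then $(1-\alpha)p\oplus\alpha q:=\gamma_{p,q}(\alpha\rho(p,q))$ for $\alpha\in[0,1]$. $X$ is a CAT(0) space if it is uniquely geodesic and $\rho((1-\alpha)x\oplus\alpha y,(1-\beta)x\oplus\beta z)\le|(1-\alpha)\bar x+\alpha\bar y-((1-\beta)\bar x+\beta\bar z)|$ whenever $\alpha,\beta\in[0,1]$, $x,y,z\in X$ and $\bar x,\bar y,\bar z\in\mathbb{R}^2$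 satisfy $\rho(x,y)=|\bar x-\bar y|$, $\rho(y,z)=|\bar y-\bar z|$, $\rho(z,x)=|\bar z-\bar x|$. An Hadamard space is a complete CAT(0) space. Tangent spaces. Let $X$ be CAT(0) and $p\in X$; $\Gamma_p$ is the set of all geodesics from $p$ (i.e. all $\gamma_{p,x}$, $x\in X$). For $x,y\ne p$ the comparison angle is $\overline{\angle}_p(x,y)=\arccos\frac{\rho(p,x)^2+\rho(p,y)^2-\rho(x,y)^2}{2\rho(p,x)\rho(p,y)}$. The Alexandrov angle is $\angle_p(\gamma_{p,x},\gamma_{p,y})=\lim_{s,t\to+0}\overline{\angle}_p(\gamma_{p,x}(s),\gamma_{p,y}(t))$ if $x\ne p$ and $y\ne p$; it is $\pi/2$ if exactly one of $x,y$ equals $p$, and $0$ if $x=y=p$. On $[0,\infty)\times\Gamma_p$ define $\tilde d_p((\alpha,\gamma_{p,x}),(\beta,\gamma_{p,y}))=\sqrt{(\alpha\rho(p,x))^2+(\beta\rho(p,y))^2-2\alpha\rho(p,x)\beta\rho(p,y)\cos\angle_p(\gamma_{p,x},\gamma_{p,y})}$, which is a pseudometric. The tangent space $T_pX$ is the quotient metric space of $[0,\infty)\times\Gamma_p$ under $(\alpha,\gamma)\sim(\beta,\eta)\iff\tilde d_p((\alpha,\gamma),(\beta,\eta))=0$, with induced metric $d_p$; the class of $(\alpha,\gamma)$ is written $\alpha\gamma$, the class of $(1,\gamma)$ is written $\gamma$, and $0_p$ is the class of $(0,\gamma_{p,p})$. Define $g_p\colon T_pX\times T_pX\to\mathbb{R}$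 by $g_p(u,v)=\frac12\big(d_p(u,0_p)^2+d_p(v,0_p)^2-d_p(u,v)^2\big)$; thus $g_p(\alpha\gamma_{p,x},\beta\gamma_{p,y})=\alpha\rho(p,x)\beta\rho(p,y)\cos\angle_p(\gamma_{p,x},\gamma_{p,y})$. Monotone vector fields. $TX=\bigcup_{x\in X}T_xX$. A vector field on $X$ is a map $A\colon X\to2^{TX}$ with $Ax\subset T_xX$ for all $x$. It is monotone if $g_x(x^*,\gamma_{x,y})+g_y(y^*,\gamma_{y,x})\le0$ whenever $x,y\in X$, $x^*\in Ax$, $y^*\in Ay$. A monotone vector field satisfies the surjectivity condition if for all $\lambda>0$ and $x\in X$ there is $z\in X$ with $\frac1\lambda\gamma_{z,x}\in Az$. In this case the resolvent is $J_\lambda x=\{z\in X:\frac1\lambda\gamma_{z,x}\in Az\}$; this set is a singleton, and $J_\lambda$ is regarded as a map $X\to X$. $\mathcal{Z}(A)=\{u\in X:0_u\in Au\}$. $\Delta$-convergence. The asymptotic center of a sequence $\{x_n\}$ in $X$ is $\mathcal{A}(\{x_n\})=\{z\in X:\limsup_n\rho(z,x_n)\le\limsup_n\rho(y,x_n)\ \forall y\in X\}$. $\{x_n\}$ is $\Delta$-convergent to $p\in X$ if $\mathcal{A}(\{x_{n_i}\})=\{p\}$ for every subsequence $\{x_{n_i}\}$ of $\{x_n\}$. *)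

theory Defs
  imports "HOL-Analysis.Analysis"
begin

section \<open>Geodesics and Hadamard spaces\<close>

text \<open>Geodesics are partial maps, defined on an interval only. They are represented by functions on
  the reals that are extensional on that interval, so that uniqueness of geodesics is equality of
  functions.\<close>

context metric_space
begin

definition is_geodesic :: "'a \<Rightarrow> 'a \<Rightarrow> (real \<Rightarrow> 'a) \<Rightarrow> bool" where
  "is_geodesic p q \<gamma> \<longleftrightarrow>
     \<gamma> \<in> extensional {0..dist p q} \<and> \<gamma> 0 = p \<and> \<gamma> (dist p q) = q \<and>
     (\<forall>s\<in>{0..dist p q}. \<forall>t\<in>{0..dist p q}. dist (\<gamma> s) (\<gamma> t) = \<bar>s - t\<bar>)"

definition geod :: "'a \<Rightarrow> 'a \<Rightarrow> real \<Rightarrow> 'a" where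
  "geod p q = (THE \<gamma>. is_geodesic p q \<gamma>)"

text \<open>The point \<open>gcomb \<alpha> p q\<close> is $(1-\alpha)p \oplus \alpha q$.\<close>

definition gcomb :: "real \<Rightarrow> 'a \<Rightarrow> 'a \<Rightarrow> 'a" where
  "gcomb \<alpha> p q = geod p q (\<alpha> * dist p q)"

end

class cat0_space = metric_space +
  assumes unique_geodesic: "\<exists>!\<gamma>. is_geodesic p q \<gamma>"
    and cat0_comparison:
      "\<lbrakk>\<alpha> \<in> {0..1}; \<beta> \<in> {0..1};
        dist x y = norm (x' - y'); dist y z = norm (y' - z'); dist z x = norm (z' - (x' :: real^2))\<rbrakk>
       \<Longrightarrow> dist (gcomb \<alpha> x y) (gcomb \<beta> x z)
            \<le> norm (((1 - \<alpha>) *\<^sub>R x' + \<alpha> *\<^sub>R y') - ((1 - \<beta>) *\<^sub>R x' + \<beta> *\<^sub>R z'))"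

class hadamard_space = cat0_space + complete_space


section \<open>Tangent spaces\<close>

definition geodesics_from :: "'a::metric_space \<Rightarrow> (real \<Rightarrow> 'a) set" where
  "geodesics_from p = {\<gamma>. \<exists>x. is_geodesic p x \<gamma>}"

definition geod_end :: "'a::metric_space \<Rightarrow> (real \<Rightarrow> 'a) \<Rightarrow> 'a" where
  "geod_end p \<gamma> = (THE x. is_geodesic p x \<gamma>)"

text \<open>The end point is determined by the geodesic: an extensional function is constant outside
  its interval, while a geodesic is injective on it.\<close>

lemma is_geodesic_end_unique:
  assumes "is_geodesic p x \<gamma>" "is_geodesic p y \<gamma>"
  shows "x = y"
proof -
  have *: "\<not> dist p x < dist p y"
    if gx: "is_geodesic p x \<gamma>" and gy: "is_geodesic p y \<gamma>" for x y :: 'a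
  proof
    assume less: "dist p x < dist p y"
    define m where "m = (dist p x + dist p y) / 2"
    have m: "dist p x < m" "m < dist p y" using less by (auto simp: m_def)
    have "0 \<le> dist p x" by simp
    have "\<gamma> m = undefined" "\<gamma> (dist p y) = undefined"
      using gx m less by (auto simp: is_geodesic_def extensional_def)
    moreover have "dist (\<gamma> m) (\<gamma> (dist p y)) = \<bar>m - dist p y\<bar>"
      using gy m \<open>0 \<le> dist p x\<close> unfolding is_geodesic_def
      by (metis atLeastAtMost_iff less_eq_real_def order_trans)
    ultimately show False using m by simp
  qed
  from *[OF assms] *[OF assms(2,1)] have "dist p x = dist p y" by linarith
  with assms show ?thesis by (auto simp: is_geodesic_def)
qed

lemma geod_end_eq: "is_geodesic p x \<gamma> \<Longrightarrow> geod_end p \<gamma> = x"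
  unfolding geod_end_def by (blast intro: is_geodesic_end_unique)

definition comparison_angle :: "'a::metric_space \<Rightarrow> 'a \<Rightarrow> 'a \<Rightarrow> real" where
  "comparison_angle p x y =
     arccos (((dist p x)\<^sup>2 + (dist p y)\<^sup>2 - (dist x y)\<^sup>2) / (2 * dist p x * dist p y))"

definition alexandrov_angle ::
    "'a::metric_space \<Rightarrow> (real \<Rightarrow> 'a) \<Rightarrow> (real \<Rightarrow> 'a) \<Rightarrow> real" where
  "alexandrov_angle p \<gamma> \<eta> =
     (if geod_end p \<gamma> \<noteq> p \<and> geod_end p \<eta> \<noteq> p
      then Lim (at_right 0 \<times>\<^sub>F at_right 0) (\<lambda>(s, t). comparison_angle p (\<gamma> s) (\<eta> t))
      else if geod_end p \<gamma> = p \<and> geod_end p \<eta> = p then 0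
      else pi / 2)"

fun pre_tangent_dist ::
    "'a::metric_space \<Rightarrow> real \<times> (real \<Rightarrow> 'a) \<Rightarrow> real \<times> (real \<Rightarrow> 'a) \<Rightarrow> real" where
  "pre_tangent_dist p (\<alpha>, \<gamma>) (\<beta>, \<eta>) =
     sqrt ((\<alpha> * dist p (geod_end p \<gamma>))\<^sup>2 + (\<beta> * dist p (geod_end p \<eta>))\<^sup>2
           - 2 * (\<alpha> * dist p (geod_end p \<gamma>)) * (\<beta> * dist p (geod_end p \<eta>))
               * cos (alexandrov_angle p \<gamma> \<eta>))"

definition pre_tangent_space :: "'a::metric_space \<Rightarrow> (real \<times> (real \<Rightarrow> 'a)) set" where
  "pre_tangent_space p = {0..} \<times> geodesics_from p"

definition tangent_rel ::
    "'a::metric_space \<Rightarrow> ((real \<times> (real \<Rightarrow> 'a)) \<times> (real \<times> (real \<Rightarrow> 'a))) set" where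
  "tangent_rel p = {(u, v). u \<in> pre_tangent_space p \<and> v \<in> pre_tangent_space p \<and>
                            pre_tangent_dist p u v = 0}"

text \<open>Tangent vectors are equivalence classes.\<close>

type_synonym 'a tangent = "(real \<times> (real \<Rightarrow> 'a)) set"

definition tangent_space :: "'a::metric_space \<Rightarrow> 'a tangent set" where
  "tangent_space p = pre_tangent_space p // tangent_rel p"

definition tangent_class :: "'a::metric_space \<Rightarrow> real \<Rightarrow> (real \<Rightarrow> 'a) \<Rightarrow> 'a tangent" where
  "tangent_class p \<alpha> \<gamma> = tangent_rel p `` {(\<alpha>, \<gamma>)}"

text \<open>The common value of the pseudometric on all pairs of representatives.\<close>

definition tangent_dist :: "'a::metric_space \<Rightarrow> 'a tangent \<Rightarrow> 'a tangent \<Rightarrow> real" where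
  "tangent_dist p U V = (THE r. \<forall>u\<in>U. \<forall>v\<in>V. pre_tangent_dist p u v = r)"

definition tangent_zero :: "'a::metric_space \<Rightarrow> 'a tangent" where
  "tangent_zero p = tangent_class p 0 (geod p p)"

definition tangent_inner :: "'a::metric_space \<Rightarrow> 'a tangent \<Rightarrow> 'a tangent \<Rightarrow> real" where
  "tangent_inner p u v =
     ((tangent_dist p u (tangent_zero p))\<^sup>2 + (tangent_dist p v (tangent_zero p))\<^sup>2
      - (tangent_dist p u v)\<^sup>2) / 2"


section \<open>Monotone vector fields\<close>

text \<open>Tangent spaces at different points are disjoint, since geodesics remember their starting
  point; hence their plain union serves as the tangent bundle.\<close>

definition vector_field :: "('a::metric_space \<Rightarrow> 'a tangent set) \<Rightarrow> bool" where
  "vector_field A \<longleftrightarrow> (\<forall>x. A x \<subseteq> tangent_space x)"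

definition monotone_vector_field :: "('a::metric_space \<Rightarrow> 'a tangent set) \<Rightarrow> bool" where
  "monotone_vector_field A \<longleftrightarrow>
     vector_field A \<and>
     (\<forall>x y. \<forall>x'\<in>A x. \<forall>y'\<in>A y.
        tangent_inner x x' (tangent_class x 1 (geod x y))
        + tangent_inner y y' (tangent_class y 1 (geod y x)) \<le> 0)"

definition resolvent_set ::
    "('a::metric_space \<Rightarrow> 'a tangent set) \<Rightarrow> real \<Rightarrow> 'a \<Rightarrow> 'a set" where
  "resolvent_set A lam x = {z. tangent_class z (1 / lam) (geod z x) \<in> A z}"

definition surjectivity_condition :: "('a::metric_space \<Rightarrow> 'a tangent set) \<Rightarrow> bool" where
  "surjectivity_condition A \<longleftrightarrow>
     (\<forall>lam>0. \<forall>x. \<exists>z. tangent_class z (1 / lam) (geod z x) \<in> A z)"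

text \<open>For a monotone vector field with the surjectivity condition and \<open>lam > 0\<close>, the set
  \<open>resolvent_set A lam x\<close> is a singleton.\<close>

definition resolvent :: "('a::metric_space \<Rightarrow> 'a tangent set) \<Rightarrow> real \<Rightarrow> 'a \<Rightarrow> 'a" where
  "resolvent A lam x = the_elem (resolvent_set A lam x)"

definition zeros :: "('a::metric_space \<Rightarrow> 'a tangent set) \<Rightarrow> 'a set" where
  "zeros A = {u. tangent_zero u \<in> A u}"


section \<open>Delta-convergence\<close>

text \<open>The limits superior are extended reals, as the sequence may be unbounded.\<close>

definition asymptotic_center :: "(nat \<Rightarrow> 'a::metric_space) \<Rightarrow> 'a set" where
  "asymptotic_center x =
     {z. \<forall>y. limsup (\<lambda>n. ereal (dist z (x n))) \<le> limsup (\<lambda>n. ereal (dist y (x n)))}"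

definition delta_convergent_to :: "(nat \<Rightarrow> 'a::metric_space) \<Rightarrow> 'a \<Rightarrow> bool" where
  "delta_convergent_to x p \<longleftrightarrow>
     (\<forall>r :: nat \<Rightarrow> nat. strict_mono r \<longrightarrow> asymptotic_center (x \<circ> r) = {p})"

end

theory Submission imports Defs begin

text \<open>Write \<open>Q p x y\<close> for half of $\rho(p,x)^2 + \rho(p,y)^2 - \rho(x,y)^2$. The CAT(0) inequality says
  that \<open>Q\<close>, divided by the product of the distances from \<open>p\<close>, does not decrease when \<open>x\<close> and \<open>y\<close> slide
  along geodesics towards \<open>p\<close>. Hence Alexandrov angles exist and the inner product of the tangent
  vectors $\alpha\gamma_{p,x}$ and $\beta\gamma_{p,y}$ is at least $\alpha\beta\,Q(p,x,y)$
  (\<open>tangent_inner_class_ge\<close>). This lower bound is all that is needed of the tangent spaces: it turns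
  monotonicity of the vector field into inequalities between squared distances (\<open>monotone_qip\<close>).

  The inequalities have four consequences. Resolvents are single-valued. Every zero \<open>u\<close> satisfies
  $\rho(x_{n+1},x_n)^2 + \rho(u,x_{n+1})^2 \le \rho(u,x_n)^2$, so the distances to zeros decrease and
  the squared step lengths have a finite sum. The quotients $\rho(x_{n+1},x_n)/\lambda_n$ decrease.
  Finally, with \<open>q\<close> the resolvent with parameter 1 of any point \<open>p\<close>,
  $\rho(q,p)^2 + \rho(q,x_{n+1})^2 \le \rho(p,x_{n+1})^2 - (2/\lambda_n)\,Q(x_{n+1},x_n,q)$.

  Superior limits of weighted means of the squared distances to a bounded sequence are strongly convex
  functions, so they have a unique minimizer \<open>p\<close> (\<open>limsup_mean_square_minimizer\<close>). If the
  sequence is bounded and the sum of the $\lambda_n$ diverges, take the weights proportional to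
  $\lambda_n$: the error terms in the last inequality telescope and vanish in the mean, whence
  \<open>q = p\<close> and \<open>p\<close> is a zero. If there is a zero and the sum of the $\lambda_n^2$ diverges, then
  $\rho(x_{n+1},x_n)/\lambda_n$ tends to 0, since its products with $\lambda_n$ are square-summable; so
  the same inequality shows that the asymptotic center of every subsequence is a zero. As the distances
  to zeros converge, all these centers coincide.\<close>


section \<open>Geodesics and comparison in CAT(0) spaces\<close>

lemma is_geodesic_geod: "is_geodesic p q (geod p (q::'a::cat0_space))"
  unfolding geod_def by (rule theI'[OF unique_geodesic])

lemma geod_eqI: "is_geodesic p q \<gamma> \<Longrightarrow> geod p (q::'a::cat0_space) = \<gamma>"
  using unique_geodesic is_geodesic_geod by blast

lemma geod_end_geod [simp]: "geod_end p (geod p (q::'a::cat0_space)) = q"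
  by (rule geod_end_eq) (rule is_geodesic_geod)

lemma geodesics_from_eq: "geodesics_from (p::'a::cat0_space) = range (geod p)"
  unfolding geodesics_from_def using is_geodesic_geod geod_eqI by blast

lemma geod_0 [simp]: "geod p q 0 = (p::'a::cat0_space)"
  and geod_dist [simp]: "geod p q (dist p q) = q"
  and dist_geod_geod:
    "\<lbrakk>s \<in> {0..dist p q}; t \<in> {0..dist p q}\<rbrakk> \<Longrightarrow> dist (geod p q s) (geod p q t) = \<bar>s - t\<bar>"
  using is_geodesic_geod[of p q] unfolding is_geodesic_def by blast+

lemma dist_geod:
  fixes p :: "'a::cat0_space"
  assumes "s \<in> {0..dist p q}"
  shows "dist p (geod p q s) = s"
  using dist_geod_geod[of 0 p q s] assms by simp

lemma gcomb_0 [simp]: "gcomb 0 p q = (p::'a::cat0_space)"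
  and gcomb_1 [simp]: "gcomb 1 p q = q"
  by (simp_all add: gcomb_def)

lemma gcomb_refl [simp]: "gcomb a p p = (p::'a::cat0_space)"
  by (simp add: gcomb_def)

lemma mult_dist_mem: "a \<in> {0..1} \<Longrightarrow> a * dist p q \<in> {0..dist p q}"
  by (auto simp: mult_left_le_one_le)

lemma dist_gcomb:
  fixes p :: "'a::cat0_space"
  assumes "a \<in> {0..1}"
  shows "dist p (gcomb a p q) = a * dist p q"
  unfolding gcomb_def by (rule dist_geod) (rule mult_dist_mem[OF assms])

text \<open>An initial segment of a geodesic is the geodesic to its own end point.\<close>

lemma geod_geod:
  fixes p :: "'a::cat0_space"
  assumes "s \<in> {0..dist p q}" and "t \<in> {0..s}"
  shows "geod p (geod p q s) t = geod p q t"
proof -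
  have d: "dist p (geod p q s) = s" using assms(1) by (rule dist_geod)
  have "is_geodesic p (geod p q s) (restrict (geod p q) {0..s})"
    unfolding is_geodesic_def d using assms(1) by (auto simp: dist_geod_geod)
  then have "geod p (geod p q s) = restrict (geod p q) {0..s}" by (rule geod_eqI)
  then show ?thesis using assms(2) by simp
qed

text \<open>The quasi-inner product of the bound vectors from \<open>p\<close> to \<open>x\<close> and from \<open>p\<close> to \<open>y\<close>: the value
  that the law of cosines assigns to the inner product.\<close>

definition qip :: "'a::metric_space \<Rightarrow> 'a \<Rightarrow> 'a \<Rightarrow> real" where
  "qip p x y = ((dist p x)\<^sup>2 + (dist p y)\<^sup>2 - (dist x y)\<^sup>2) / 2"

lemma abs_qip_le: "\<bar>qip p x y\<bar> \<le> dist p x * dist p y"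
proof -
  have 1: "dist x y \<le> dist p x + dist p y" by (metis dist_commute dist_triangle)
  have 2: "\<bar>dist p x - dist p y\<bar> \<le> dist x y"
    using dist_triangle[of p x y] dist_triangle[of p y x] by (simp add: dist_commute abs_le_iff)
  have "(dist x y)\<^sup>2 \<le> (dist p x + dist p y)\<^sup>2" using 1 by (simp add: power_mono)
  moreover have "(dist p x - dist p y)\<^sup>2 \<le> (dist x y)\<^sup>2"
    using power_mono[OF 2, of 2] by simp
  ultimately show ?thesis unfolding qip_def abs_le_iff power2_sum power2_diff
    by (simp add: field_simps)
qed

lemma norm_vector_2: "norm (vector [a, b] :: real^2) = sqrt (a\<^sup>2 + b\<^sup>2)"
  by (simp add: norm_vec_def L2_set_def sum_2)

lemma comparison_triangle_exists:
  fixes x y z :: "'a::metric_space"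
  obtains y' z' :: "real^2"
  where "norm y' = dist x y" "norm z' = dist x z" "norm (y' - z') = dist y z"
proof (cases "x = y")
  case True
  have "norm (vector [dist x z, 0] :: real^2) = dist x z" by (simp add: norm_vector_2)
  then show ?thesis using True that[of 0 "vector [dist x z, 0]"] by simp
next
  case False
  define d where "d = dist x y"
  define c where "c = qip x y z / d"
  define h where "h = sqrt ((dist x z)\<^sup>2 - c\<^sup>2)"
  have d: "d > 0" using False by (simp add: d_def)
  have "\<bar>c\<bar> \<le> dist x z"
    using abs_qip_le[of x y z] d by (simp add: c_def d_def field_simps)
  then have "c\<^sup>2 \<le> (dist x z)\<^sup>2" using abs_le_square_iff[of c "dist x z"] by simp
  then have h: "h\<^sup>2 = (dist x z)\<^sup>2 - c\<^sup>2" by (simp add: h_def)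
  have cd: "2 * c * d = d\<^sup>2 + (dist x z)\<^sup>2 - (dist y z)\<^sup>2"
    using d by (simp add: c_def qip_def d_def)
  have "vector [d, 0] - vector [c, h] = (vector [d - c, - h] :: real^2)"
    by (simp add: vec_eq_iff forall_2)
  then have "norm (vector [d, 0] - vector [c, h] :: real^2) = sqrt ((d - c)\<^sup>2 + h\<^sup>2)"
    by (simp add: norm_vector_2)
  also have "(d - c)\<^sup>2 + h\<^sup>2 = (dist y z)\<^sup>2"
    using h cd by (simp add: power2_eq_square algebra_simps)
  finally have "norm (vector [d, 0] - vector [c, h] :: real^2) = dist y z" by simp
  then show ?thesis
    using that[of "vector [d, 0]" "vector [c, h]"] d h by (simp add: norm_vector_2 d_def)
qed

text \<open>The CAT(0) inequality, freed of comparison triangles. Since distances from \<open>p\<close> scale exactly, it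
  says that comparison angles do not increase towards the vertex.\<close>

lemma qip_gcomb:
  fixes p :: "'a::cat0_space"
  assumes a: "a \<in> {0..1}" and b: "b \<in> {0..1}"
  shows "a * b * qip p x y \<le> qip p (gcomb a p x) (gcomb b p y)"
proof -
  obtain x' y' :: "real^2" where
    n: "norm x' = dist p x" "norm y' = dist p y" "norm (x' - y') = dist x y"
    by (rule comparison_triangle_exists)
  have "dist (gcomb a p x) (gcomb b p y) \<le>
      norm (((1 - a) *\<^sub>R 0 + a *\<^sub>R x') - ((1 - b) *\<^sub>R 0 + b *\<^sub>R y'))"
    by (rule cat0_comparison[OF a b]) (use n in \<open>simp_all add: dist_commute\<close>)
  then have "(dist (gcomb a p x) (gcomb b p y))\<^sup>2 \<le> (norm (a *\<^sub>R x' - b *\<^sub>R y'))\<^sup>2"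
    by (simp add: power_mono)
  also have "\<dots> = (a * norm x')\<^sup>2 + (b * norm y')\<^sup>2 - a * b * ((norm x')\<^sup>2 + (norm y')\<^sup>2 - (norm (x' - y'))\<^sup>2)"
    unfolding power_mult_distrib power2_norm_eq_inner
    by (simp add: inner_diff_left inner_diff_right inner_commute power2_eq_square algebra_simps)
  also have "\<dots> = (a * dist p x)\<^sup>2 + (b * dist p y)\<^sup>2 - 2 * (a * b * qip p x y)"
    by (simp add: n qip_def)
  finally show ?thesis
    using a b by (simp add: qip_def[of p "gcomb a p x"] dist_gcomb)
qed

text \<open>The inequality of Bruhat and Tits: squared distance functions are strongly convex.\<close>

lemma CN_inequality:
  fixes y :: "'a::cat0_space"
  shows "(dist (gcomb (1/2) y z) w)\<^sup>2 \<le> (dist y w)\<^sup>2 / 2 + (dist z w)\<^sup>2 / 2 - (dist y z)\<^sup>2 / 4"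
  using qip_gcomb[of "1/2" 1 y z w] dist_gcomb[of "1/2" y z]
  by (simp add: qip_def field_simps power2_eq_square)


section \<open>The Alexandrov angle and the tangent space\<close>

lemma cos_comparison_angle:
  assumes "x \<noteq> p" "y \<noteq> p"
  shows "cos (comparison_angle p x y) = qip p x y / (dist p x * dist p y)"
proof -
  have pos: "dist p x * dist p y > 0" using assms by simp
  have "\<bar>qip p x y / (dist p x * dist p y)\<bar> \<le> 1"
    using abs_qip_le[of p x y] pos by simp
  moreover have "comparison_angle p x y = arccos (qip p x y / (dist p x * dist p y))"
    by (simp add: comparison_angle_def qip_def mult.assoc)
  ultimately show ?thesis by (simp only: cos_arccos_abs)
qed

lemma comparison_angle_bounds:
  assumes "x \<noteq> p" "y \<noteq> p"
  shows "comparison_angle p x y \<in> {0..pi}"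
proof -
  define c where "c = qip p x y / (dist p x * dist p y)"
  have pos: "dist p x * dist p y > 0" using assms by simp
  have "\<bar>c\<bar> \<le> 1"
    using abs_qip_le[of p x y] pos by (simp add: c_def)
  moreover have "comparison_angle p x y = arccos c"
    by (simp add: comparison_angle_def qip_def c_def mult.assoc)
  ultimately show ?thesis using arccos_bounded[of c] by (simp add: abs_le_iff)
qed

lemma comparison_angle_mono:
  fixes p :: "'a::cat0_space"
  assumes s: "0 < s" "s \<le> s'" "s' \<le> dist p x" and t: "0 < t" "t \<le> t'" "t' \<le> dist p y"
  shows "comparison_angle p (geod p x s) (geod p y t) \<le> comparison_angle p (geod p x s') (geod p y t')"
proof -
  have d: "dist p (geod p x s) = s" "dist p (geod p x s') = s'"
    "dist p (geod p y t) = t" "dist p (geod p y t') = t'"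
    using s t by (simp_all add: dist_geod)
  have ne: "geod p x s \<noteq> p" "geod p x s' \<noteq> p" "geod p y t \<noteq> p" "geod p y t' \<noteq> p"
    using d s t by auto
  have "gcomb (s/s') p (geod p x s') = geod p x s" "gcomb (t/t') p (geod p y t') = geod p y t"
    using s t by (simp_all add: gcomb_def d geod_geod)
  then have "(s/s') * (t/t') * qip p (geod p x s') (geod p y t') \<le> qip p (geod p x s) (geod p y t)"
    using qip_gcomb[of "s/s'" "t/t'" p "geod p x s'" "geod p y t'"] s t by simp
  then have "qip p (geod p x s') (geod p y t') / (s' * t') \<le> qip p (geod p x s) (geod p y t) / (s * t)"
    using s t by (simp add: field_simps)
  then have "cos (comparison_angle p (geod p x s') (geod p y t'))
      \<le> cos (comparison_angle p (geod p x s) (geod p y t))"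
    by (simp add: cos_comparison_angle ne d)
  then show ?thesis
    using comparison_angle_bounds[OF ne(1,3)] comparison_angle_bounds[OF ne(2,4)]
    by (simp add: cos_mono_le_eq)
qed

lemma mono_tendsto_at_right_0_prod:
  fixes f :: "real \<Rightarrow> real \<Rightarrow> real"
  assumes "0 < a" "0 < b"
    and mono: "\<And>s s' t t'. \<lbrakk>0 < s; s \<le> s'; s' \<le> a; 0 < t; t \<le> t'; t' \<le> b\<rbrakk> \<Longrightarrow> f s t \<le> f s' t'"
    and bound: "\<And>s t. \<lbrakk>0 < s; s \<le> a; 0 < t; t \<le> b\<rbrakk> \<Longrightarrow> c \<le> f s t"
  obtains L where "((\<lambda>(s, t). f s t) \<longlongrightarrow> L) (at_right 0 \<times>\<^sub>F at_right 0)" "c \<le> L" "L \<le> f a b"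
proof -
  define V where "V = (\<lambda>(s, t). f s t) ` ({0<..a} \<times> {0<..b})"
  have ne: "V \<noteq> {}" using assms(1,2) by (auto simp: V_def)
  have bdd: "bdd_below V" unfolding V_def by (rule bdd_belowI[where m = c]) (use bound in auto)
  have low: "Inf V \<le> f s t" if "0 < s" "s \<le> a" "0 < t" "t \<le> b" for s t
    using that by (intro cInf_lower bdd) (auto simp: V_def)
  have "((\<lambda>(s, t). f s t) \<longlongrightarrow> Inf V) (at_right 0 \<times>\<^sub>F at_right 0)"
  proof (rule order_tendstoI)
    fix e assume e: "e < Inf V"
    have "\<forall>\<^sub>F s in at_right 0. s \<in> {0<..<a}" "\<forall>\<^sub>F t in at_right 0. t \<in> {0<..<b}"
      using assms(1,2) by (simp_all only: eventually_at_right_real)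
    from eventually_prodI[OF this]
    show "\<forall>\<^sub>F x in at_right 0 \<times>\<^sub>F at_right 0. e < (case x of (s, t) \<Rightarrow> f s t)"
    proof eventually_elim
      case (elim z)
      then have "Inf V \<le> f (fst z) (snd z)" by (intro low) auto
      then show ?case using e by (simp add: case_prod_beta)
    qed
  next
    fix e assume "Inf V < e"
    then obtain s' t' where *: "0 < s'" "s' \<le> a" "0 < t'" "t' \<le> b" "f s' t' < e"
      using ne bdd by (auto simp: cInf_less_iff V_def)
    have "\<forall>\<^sub>F s in at_right 0. s \<in> {0<..<s'}" "\<forall>\<^sub>F t in at_right 0. t \<in> {0<..<t'}"
      using * by (simp_all only: eventually_at_right_real)
    from eventually_prodI[OF this]
    show "\<forall>\<^sub>F x in at_right 0 \<times>\<^sub>F at_right 0. (case x of (s, t) \<Rightarrow> f s t) < e"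
    proof eventually_elim
      case (elim z)
      then have "f (fst z) (snd z) \<le> f s' t'" using * by (intro mono) auto
      then show ?case using *(5) by (simp add: case_prod_beta)
    qed
  qed
  moreover have "c \<le> Inf V" using bound by (intro cInf_greatest ne) (auto simp: V_def)
  ultimately show ?thesis using that low assms(1,2) by blast
qed

lemma alexandrov_angle_limit:
  fixes p :: "'a::cat0_space"
  assumes x: "x \<noteq> p" and y: "y \<noteq> p"
  shows tendsto_alexandrov_angle:
      "((\<lambda>(s, t). comparison_angle p (geod p x s) (geod p y t)) \<longlongrightarrow>
        alexandrov_angle p (geod p x) (geod p y)) (at_right 0 \<times>\<^sub>F at_right 0)"
    and alexandrov_angle_le: "alexandrov_angle p (geod p x) (geod p y) \<le> comparison_angle p x y"
    and alexandrov_angle_nonneg: "0 \<le> alexandrov_angle p (geod p x) (geod p y)"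
proof -
  have bound: "0 \<le> comparison_angle p (geod p x s) (geod p y t)"
    if "0 < s" "s \<le> dist p x" "0 < t" "t \<le> dist p y" for s t
  proof -
    have "geod p x s \<noteq> p" "geod p y t \<noteq> p"
      using that dist_geod[of s p x] dist_geod[of t p y] by auto
    then show ?thesis using comparison_angle_bounds[of "geod p x s" p "geod p y t"] by simp
  qed
  obtain L where L: "((\<lambda>(s, t). comparison_angle p (geod p x s) (geod p y t)) \<longlongrightarrow> L)
      (at_right 0 \<times>\<^sub>F at_right 0)" "0 \<le> L" "L \<le> comparison_angle p x y"
    by (rule mono_tendsto_at_right_0_prod[where a = "dist p x" and b = "dist p y" and c = 0
          and f = "\<lambda>s t. comparison_angle p (geod p x s) (geod p y t)"])
      (use x y comparison_angle_mono bound in auto)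
  have "alexandrov_angle p (geod p x) (geod p y) = L"
    unfolding alexandrov_angle_def using x y
    by (simp add: tendsto_Lim[OF _ L(1)] prod_filter_eq_bot)
  with L show "((\<lambda>(s, t). comparison_angle p (geod p x s) (geod p y t)) \<longlongrightarrow>
        alexandrov_angle p (geod p x) (geod p y)) (at_right 0 \<times>\<^sub>F at_right 0)"
    "alexandrov_angle p (geod p x) (geod p y) \<le> comparison_angle p x y"
    "0 \<le> alexandrov_angle p (geod p x) (geod p y)" by auto
qed

text \<open>The angle at \<open>p\<close> is at most the comparison angle. If \<open>x\<close> or \<open>y\<close> equals \<open>p\<close>, both sides vanish, whatever
  the convention for the angle.\<close>

lemma qip_le_cos_alexandrov_angle:
  fixes p :: "'a::cat0_space"
  shows "qip p x y \<le> dist p x * dist p y * cos (alexandrov_angle p (geod p x) (geod p y))"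
proof (cases "x = p \<or> y = p")
  case True
  then show ?thesis using abs_qip_le[of p x y] by auto
next
  case False
  then have ne: "x \<noteq> p" "y \<noteq> p" by auto
  have "cos (comparison_angle p x y) \<le> cos (alexandrov_angle p (geod p x) (geod p y))"
    using alexandrov_angle_le[OF ne] alexandrov_angle_nonneg[OF ne] comparison_angle_bounds[OF ne]
    by (intro cos_monotone_0_pi_le) auto
  then show ?thesis using ne by (simp add: cos_comparison_angle field_simps)
qed

text \<open>The distance in the tangent cone is the limit of rescaled distances in the space. Hence it
  inherits the triangle inequality.\<close>

lemma tendsto_pre_tangent_dist:
  fixes p :: "'a::cat0_space"
  assumes a: "0 \<le> a" and b: "0 \<le> b"
  shows "((\<lambda>t. dist (gcomb (t * a) p x) (gcomb (t * b) p y) / t) \<longlongrightarrow>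
      pre_tangent_dist p (a, geod p x) (b, geod p y)) (at_right 0)"
proof -
  define s where "s = a * dist p x"
  define r where "r = b * dist p y"
  have nonneg: "0 \<le> s" "0 \<le> r" using a b by (simp_all add: s_def r_def)
  \<comment> \<open>Below \<open>e\<close> both rescaled parameters stay in the unit interval.\<close>
  define e where "e = min 1 (1 / (a + b + 1))"
  have e: "0 < e" using a b by (simp add: e_def)
  have ta: "t * a \<in> {0..1}" and tb: "t * b \<in> {0..1}" if t: "t \<in> {0<..<e}" for t
  proof -
    have "t * (a + b + 1) \<le> 1" using t a b by (simp add: e_def field_simps)
    moreover have "0 \<le> t * a" "0 \<le> t * b" "0 \<le> t" using t a b by simp_all
    ultimately show "t * a \<in> {0..1}" "t * b \<in> {0..1}" by (auto simp: algebra_simps)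
  qed
  have dx: "dist p (gcomb (t * a) p x) = t * s" if "t \<in> {0<..<e}" for t
    using dist_gcomb[OF ta[OF that]] by (simp add: s_def mult.assoc)
  have dy: "dist p (gcomb (t * b) p y) = t * r" if "t \<in> {0<..<e}" for t
    using dist_gcomb[OF tb[OF that]] by (simp add: r_def mult.assoc)
  have ev: "\<forall>\<^sub>F t in at_right 0. t \<in> {0<..<e}" using e by (rule eventually_at_right_real)
  consider "s = 0" | "r = 0" | "0 < s" "0 < r" using nonneg by linarith
  then show ?thesis
  proof cases
    case 1
    have "\<forall>\<^sub>F t in at_right 0. dist (gcomb (t * a) p x) (gcomb (t * b) p y) / t = r"
      using ev
    proof eventually_elim
      case (elim t)
      then have "gcomb (t * a) p x = p" using dx[of t] 1 by simp
      then show ?case using dy[of t] elim by simp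
    qed
    moreover have "pre_tangent_dist p (a, geod p x) (b, geod p y) = r"
      using 1 nonneg
      by (simp only: pre_tangent_dist.simps geod_end_geod s_def[symmetric] r_def[symmetric]) simp
    ultimately show ?thesis by (simp only: tendsto_eventually)
  next
    case 2
    have "\<forall>\<^sub>F t in at_right 0. dist (gcomb (t * a) p x) (gcomb (t * b) p y) / t = s"
      using ev
    proof eventually_elim
      case (elim t)
      then have "gcomb (t * b) p y = p" using dy[of t] 2 by simp
      then show ?case using dx[of t] elim by (simp add: dist_commute)
    qed
    moreover have "pre_tangent_dist p (a, geod p x) (b, geod p y) = s"
      using 2 nonneg
      by (simp only: pre_tangent_dist.simps geod_end_geod s_def[symmetric] r_def[symmetric]) simp
    ultimately show ?thesis by (simp only: tendsto_eventually)
  next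
    case 3
    then have ne: "x \<noteq> p" "y \<noteq> p" by (auto simp: s_def r_def)
    define \<theta> where "\<theta> = (\<lambda>t. comparison_angle p (geod p x (t * s)) (geod p y (t * r)))"
    have lin: "filterlim (\<lambda>t. t * c) (at_right 0) (at_right 0)" if "0 < c" for c :: real
    proof (rule tendsto_imp_filterlim_at_right)
      show "((\<lambda>t. t * c) \<longlongrightarrow> 0) (at_right 0)" by (auto intro!: tendsto_eq_intros)
      show "\<forall>\<^sub>F t in at_right 0. 0 < t * c"
        using that by (simp add: eventually_at_filter zero_less_mult_iff)
    qed
    have "filterlim (\<lambda>t. (t * s, t * r)) (at_right 0 \<times>\<^sub>F at_right 0) (at_right 0)"
      using 3 by (intro filterlim_Pair lin)
    from filterlim_compose[OF tendsto_alexandrov_angle[OF ne] this]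
    have "(\<theta> \<longlongrightarrow> alexandrov_angle p (geod p x) (geod p y)) (at_right 0)"
      by (simp add: \<theta>_def)
    then have lim: "((\<lambda>t. sqrt (s\<^sup>2 + r\<^sup>2 - 2 * s * r * cos (\<theta> t))) \<longlongrightarrow>
        pre_tangent_dist p (a, geod p x) (b, geod p y)) (at_right 0)"
      by (auto simp: s_def r_def intro!: tendsto_intros)
    have "\<forall>\<^sub>F t in at_right 0. sqrt (s\<^sup>2 + r\<^sup>2 - 2 * s * r * cos (\<theta> t))
        = dist (gcomb (t * a) p x) (gcomb (t * b) p y) / t"
      using ev
    proof eventually_elim
      case (elim t)
      let ?u = "gcomb (t * a) p x" and ?v = "gcomb (t * b) p y"
      have t: "0 < t" using elim by simp
      have d: "dist p ?u = t * s" "dist p ?v = t * r" using elim by (rule dx, rule dy)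
      then have "?u \<noteq> p" "?v \<noteq> p" using t 3 by auto
      moreover have "?u = geod p x (t * s)" "?v = geod p y (t * r)"
        by (simp_all add: gcomb_def s_def r_def mult.assoc)
      ultimately have "cos (\<theta> t) = qip p ?u ?v / ((t * s) * (t * r))"
        using cos_comparison_angle[of ?u p ?v] d by (simp add: \<theta>_def)
      then have "2 * s * r * cos (\<theta> t) = ((t * s)\<^sup>2 + (t * r)\<^sup>2 - (dist ?u ?v)\<^sup>2) / t\<^sup>2"
        unfolding qip_def d using t 3 by (simp add: power2_eq_square)
      then have "s\<^sup>2 + r\<^sup>2 - 2 * s * r * cos (\<theta> t) = (dist ?u ?v / t)\<^sup>2"
        using t by (simp add: power_mult_distrib power_divide diff_divide_distrib add_divide_distrib)
      then show ?case using t by simp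
    qed
    then show ?thesis by (rule tendsto_cong[THEN iffD1]) (rule lim)
  qed
qed

lemma pre_tangent_space_cases:
  fixes p :: "'a::cat0_space"
  assumes "u \<in> pre_tangent_space p"
  obtains a x where "u = (a, geod p x)" "0 \<le> a"
  using assms by (auto simp: pre_tangent_space_def geodesics_from_eq)

lemma pre_tangent_dist_commute:
  fixes p :: "'a::cat0_space"
  assumes "u \<in> pre_tangent_space p" "v \<in> pre_tangent_space p"
  shows "pre_tangent_dist p u v = pre_tangent_dist p v u"
proof -
  obtain a x where u: "u = (a, geod p x)" "0 \<le> a" using assms(1) by (rule pre_tangent_space_cases)
  obtain b y where v: "v = (b, geod p y)" "0 \<le> b" using assms(2) by (rule pre_tangent_space_cases)
  have "((\<lambda>t. dist (gcomb (t * a) p x) (gcomb (t * b) p y) / t) \<longlongrightarrow> pre_tangent_dist p v u) (at_right 0)"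
    using tendsto_pre_tangent_dist[OF v(2) u(2), of p y x] by (simp only: dist_commute u v)
  with tendsto_pre_tangent_dist[OF u(2) v(2), of p x y] show ?thesis
    unfolding u(1) v(1) by (rule tendsto_unique[rotated]) simp
qed

lemma pre_tangent_dist_triangle:
  fixes p :: "'a::cat0_space"
  assumes "u \<in> pre_tangent_space p" "v \<in> pre_tangent_space p" "w \<in> pre_tangent_space p"
  shows "pre_tangent_dist p u w \<le> pre_tangent_dist p u v + pre_tangent_dist p v w"
proof -
  obtain a x where u: "u = (a, geod p x)" "0 \<le> a" using assms(1) by (rule pre_tangent_space_cases)
  obtain b y where v: "v = (b, geod p y)" "0 \<le> b" using assms(2) by (rule pre_tangent_space_cases)
  obtain c z where w: "w = (c, geod p z)" "0 \<le> c" using assms(3) by (rule pre_tangent_space_cases)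
  note lim = tendsto_pre_tangent_dist[of _ _ p]
  show ?thesis unfolding u(1) v(1) w(1)
  proof (rule tendsto_le[OF _ tendsto_add[OF lim[of a b x y] lim[of b c y z]] lim[of a c x z]])
    show "\<forall>\<^sub>F t in at_right 0. dist (gcomb (t * a) p x) (gcomb (t * c) p z) / t
        \<le> dist (gcomb (t * a) p x) (gcomb (t * b) p y) / t
          + dist (gcomb (t * b) p y) (gcomb (t * c) p z) / t"
      using eventually_at_right_less
      by eventually_elim (simp add: add_divide_distrib[symmetric] divide_right_mono dist_triangle)
  qed (use u v w in simp_all)
qed

lemma pre_tangent_dist_self:
  fixes p :: "'a::cat0_space"
  assumes "u \<in> pre_tangent_space p"
  shows "pre_tangent_dist p u u = 0"
proof -
  obtain a x where u: "u = (a, geod p x)" "0 \<le> a" using assms by (rule pre_tangent_space_cases)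
  show ?thesis unfolding u(1)
    by (rule tendsto_unique[OF _ tendsto_pre_tangent_dist[OF u(2) u(2)]]) simp_all
qed

text \<open>By the triangle inequality the pseudometric is constant on pairs of classes, so the definite
  description in \<open>tangent_dist\<close> denotes its value.\<close>

lemma tangent_dist_class:
  fixes p :: "'a::cat0_space"
  assumes "0 \<le> a" "0 \<le> b"
  shows "tangent_dist p (tangent_class p a (geod p x)) (tangent_class p b (geod p y))
    = pre_tangent_dist p (a, geod p x) (b, geod p y)"
proof -
  let ?u = "(a, geod p x)" and ?v = "(b, geod p y)"
  have mem: "?u \<in> pre_tangent_space p" "?v \<in> pre_tangent_space p"
    using assms by (auto simp: pre_tangent_space_def geodesics_from_eq)
  have "pre_tangent_dist p u v = pre_tangent_dist p ?u ?v"
    if "u \<in> tangent_class p a (geod p x)" "v \<in> tangent_class p b (geod p y)" for u v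
  proof -
    have m: "u \<in> pre_tangent_space p" "v \<in> pre_tangent_space p"
      and z: "pre_tangent_dist p ?u u = 0" "pre_tangent_dist p ?v v = 0"
      using that by (auto simp: tangent_class_def tangent_rel_def)
    note tri = pre_tangent_dist_triangle and com = pre_tangent_dist_commute
    have "pre_tangent_dist p u v \<le> pre_tangent_dist p ?u ?v"
      using tri[OF m(1) mem(1) m(2)] tri[OF mem(1) mem(2) m(2)] com[OF m(1) mem(1)] z by linarith
    moreover have "pre_tangent_dist p ?u ?v \<le> pre_tangent_dist p u v"
      using tri[OF mem(1) m(1) mem(2)] tri[OF m(1) m(2) mem(2)] com[OF m(2) mem(2)] z by linarith
    ultimately show ?thesis by simp
  qed
  moreover have "?u \<in> tangent_class p a (geod p x)" "?v \<in> tangent_class p b (geod p y)"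
    using mem pre_tangent_dist_self[OF mem(1)] pre_tangent_dist_self[OF mem(2)]
    unfolding tangent_class_def tangent_rel_def by blast+
  ultimately show ?thesis unfolding tangent_dist_def by (intro the_equality) (blast, metis)
qed

lemma tangent_inner_class:
  fixes p :: "'a::cat0_space"
  assumes "0 \<le> a" "0 \<le> b"
  shows "tangent_inner p (tangent_class p a (geod p x)) (tangent_class p b (geod p y))
    = a * b * (dist p x * dist p y * cos (alexandrov_angle p (geod p x) (geod p y)))"
proof -
  let ?c = "cos (alexandrov_angle p (geod p x) (geod p y))"
  let ?s = "a * dist p x" and ?r = "b * dist p y"
  have "0 \<le> (?s - ?r)\<^sup>2 + 2 * (?s * ?r) * (1 - ?c)"
    using assms by (intro add_nonneg_nonneg mult_nonneg_nonneg) auto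
  then have "0 \<le> ?s\<^sup>2 + ?r\<^sup>2 - 2 * ?s * ?r * ?c"
    by (simp add: power2_eq_square algebra_simps)
  then show ?thesis
    unfolding tangent_inner_def tangent_zero_def
    using assms by (simp add: tangent_dist_class)
qed

lemma tangent_inner_class_ge:
  fixes p :: "'a::cat0_space"
  assumes "0 \<le> a" "0 \<le> b"
  shows "a * b * qip p x y \<le>
    tangent_inner p (tangent_class p a (geod p x)) (tangent_class p b (geod p y))"
  unfolding tangent_inner_class[OF assms]
  using assms by (intro mult_left_mono qip_le_cos_alexandrov_angle) simp



lemma tangent_class_refl:
  fixes p :: "'a::cat0_space"
  assumes "0 \<le> a"
  shows "tangent_class p a (geod p p) = tangent_zero p"
proof -
  have "pre_tangent_dist p (a, geod p p) v = pre_tangent_dist p (0, geod p p) v" for v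
    by (cases v) simp
  moreover have "(a, geod p p) \<in> pre_tangent_space p" "(0, geod p p) \<in> pre_tangent_space p"
    using assms by (auto simp: pre_tangent_space_def geodesics_from_eq)
  ultimately show ?thesis by (simp add: tangent_class_def tangent_zero_def tangent_rel_def)
qed


section \<open>Minimizers of mean squared distances and asymptotic centers\<close>

lemma limsup_real_exists:
  fixes f :: "nat \<Rightarrow> real"
  assumes "\<And>n. f n \<in> {0..B}"
  obtains L where "limsup (\<lambda>n. ereal (f n)) = ereal L"
proof -
  have "limsup (\<lambda>n. ereal (f n)) \<le> ereal B"
    using assms by (intro Limsup_bounded) simp
  moreover have "0 \<le> limsup (\<lambda>n. ereal (f n))"
    using assms by (intro le_Limsup) simp_all
  ultimately show ?thesis using that by (cases "limsup (\<lambda>n. ereal (f n))") auto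
qed

lemma limsup_le_combination:
  fixes f g h \<epsilon> :: "nat \<Rightarrow> real"
  assumes F: "limsup (\<lambda>n. ereal (f n)) = ereal F"
    and G: "limsup (\<lambda>n. ereal (g n)) = ereal G"
    and H: "limsup (\<lambda>n. ereal (h n)) = ereal H"
    and ab: "0 \<le> a" "0 \<le> b" and \<epsilon>: "\<epsilon> \<longlonglongrightarrow> 0"
    and le: "\<forall>\<^sub>F n in sequentially. f n \<le> a * g n + b * h n + c + \<epsilon> n"
  shows "F \<le> a * G + b * H + c"
proof (rule field_le_epsilon)
  fix e :: real assume "0 < e"
  define d where "d = e / (a + b + 1)"
  have d: "0 < d" "(a + b + 1) * d = e" using \<open>0 < e\<close> ab by (simp_all add: d_def)
  have "\<forall>\<^sub>F n in sequentially. ereal (g n) < ereal (G + d)"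
    by (rule Limsup_lessD) (use G d in simp)
  moreover have "\<forall>\<^sub>F n in sequentially. ereal (h n) < ereal (H + d)"
    by (rule Limsup_lessD) (use H d in simp)
  moreover have "\<forall>\<^sub>F n in sequentially. \<epsilon> n < d" using \<epsilon> d(1) by (rule order_tendstoD)
  ultimately have "\<forall>\<^sub>F n in sequentially. ereal (f n) \<le> ereal (a * G + b * H + c + e)"
    using le
  proof eventually_elim
    case (elim n)
    have "a * g n \<le> a * (G + d)" "b * h n \<le> b * (H + d)"
      using elim ab by (simp_all add: mult_left_mono)
    then show ?case using elim d(2) by (simp add: algebra_simps)
  qed
  then show "F \<le> a * G + b * H + c + e"
    using Limsup_bounded[of "\<lambda>n. ereal (f n)"] F by (metis ereal_less_eq(3))
qed

lemma limsup_sqrt: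
  fixes f :: "nat \<Rightarrow> real"
  assumes S: "limsup (\<lambda>n. ereal (f n)) = ereal S" and f: "\<And>n. 0 \<le> f n"
  shows "limsup (\<lambda>n. ereal (sqrt (f n))) = ereal (sqrt S)"
proof (rule antisym)
  have "0 \<le> limsup (\<lambda>n. ereal (f n))" using f by (intro le_Limsup) simp_all
  then have S0: "0 \<le> S" using S by simp
  show "limsup (\<lambda>n. ereal (sqrt (f n))) \<le> ereal (sqrt S)"
  proof (rule ereal_le_epsilon2)
    fix e :: real assume e: "0 < e"
    have "S = (sqrt S)\<^sup>2" using S0 by simp
    also have "\<dots> < (sqrt S + e)\<^sup>2" using e S0 by (intro power_strict_mono) simp_all
    finally have "\<forall>\<^sub>F n in sequentially. ereal (f n) < ereal ((sqrt S + e)\<^sup>2)"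
      by (intro Limsup_lessD) (use S in simp)
    then have "\<forall>\<^sub>F n in sequentially. ereal (sqrt (f n)) \<le> ereal (sqrt S + e)"
      by eventually_elim (use e S0 in \<open>simp add: real_le_lsqrt\<close>)
    then show "limsup (\<lambda>n. ereal (sqrt (f n))) \<le> ereal (sqrt S) + ereal e"
      using Limsup_bounded by (metis plus_ereal.simps(1))
  qed
  show "ereal (sqrt S) \<le> limsup (\<lambda>n. ereal (sqrt (f n)))"
  proof (rule ccontr)
    assume "\<not> ?thesis"
    then obtain c where c: "limsup (\<lambda>n. ereal (sqrt (f n))) < ereal c" "c < sqrt S"
      by (metis ereal_dense2 ereal_less(2) not_le less_ereal.simps(1))
    from Limsup_lessD[OF c(1)]
    have ev: "\<forall>\<^sub>F n in sequentially. sqrt (f n) < c" by simp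
    then obtain n where "sqrt (f n) < c" using eventually_happens trivial_limit_sequentially by blast
    then have c0: "0 < c" using f[of n] by (meson le_less_trans real_sqrt_ge_zero)
    have "\<forall>\<^sub>F n in sequentially. ereal (f n) \<le> ereal (c\<^sup>2)"
      using ev by eventually_elim (use c0 in \<open>simp add: sqrt_le_D\<close>)
    then have "limsup (\<lambda>n. ereal (f n)) \<le> ereal (c\<^sup>2)" by (rule Limsup_bounded)
    then have "S \<le> c\<^sup>2" using S by simp
    then show False using c(2) c0 by (simp add: real_le_lsqrt leD)
  qed
qed

text \<open>The conclusion contains uniqueness of the minimizer, by quadratic growth.\<close>

lemma strongly_convex_minimizer:
  fixes F :: "'a::hadamard_space \<Rightarrow> real"
  assumes nonneg: "\<And>y. 0 \<le> F y" and cont: "continuous_on UNIV F"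
    and mid: "\<And>y z. F (gcomb (1/2) y z) \<le> F y / 2 + F z / 2 - (dist y z)\<^sup>2 / 4"
  obtains p where "\<And>y. F p + (dist p y)\<^sup>2 / 2 \<le> F y"
proof -
  define I where "I = Inf (range F)"
  have bdd: "bdd_below (range F)" using nonneg by (intro bdd_belowI2)
  have I: "I \<le> F y" for y unfolding I_def by (intro cInf_lower bdd) simp
  have "\<exists>y. F y < I + inverse (real (Suc n))" for n
  proof -
    have "Inf (range F) < I + inverse (real (Suc n))" unfolding I_def by simp
    then show ?thesis using bdd by (subst (asm) cInf_less_iff) auto
  qed
  then obtain u where u: "\<And>n. F (u n) < I + inverse (real (Suc n))" by metis
  \<comment> \<open>The midpoint of two near-minimizers has value at least \<open>I\<close>, so they are close to each other.\<close>
  have "Cauchy u"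
  proof (rule metric_CauchyI)
    fix e :: real assume e: "0 < e"
    obtain N where N: "inverse (real (Suc N)) < e\<^sup>2 / 4"
      using reals_Archimedean[of "e\<^sup>2 / 4"] e by auto
    have "dist (u m) (u n) < e" if "N \<le> m" "N \<le> n" for m n
    proof -
      have "inverse (real (Suc m)) \<le> inverse (real (Suc N))"
        "inverse (real (Suc n)) \<le> inverse (real (Suc N))" using that by (simp_all add: field_simps)
      moreover have "I \<le> F (u m) / 2 + F (u n) / 2 - (dist (u m) (u n))\<^sup>2 / 4"
        using I mid order_trans by blast
      ultimately have "(dist (u m) (u n))\<^sup>2 < e\<^sup>2" using u[of m] u[of n] N by linarith
      then show ?thesis using e by (simp add: power2_less_imp_less)
    qed
    then show "\<exists>M. \<forall>m\<ge>M. \<forall>n\<ge>M. dist (u m) (u n) < e" by blast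
  qed
  then obtain p where p: "u \<longlonglongrightarrow> p" using Cauchy_convergent convergent_def by blast
  have "(\<lambda>n. F (u n)) \<longlonglongrightarrow> F p"
    using cont p by (auto simp: continuous_on_eq_continuous_at intro: isCont_tendsto_compose)
  moreover have "(\<lambda>n. I + inverse (real (Suc n))) \<longlonglongrightarrow> I"
    using tendsto_add[OF tendsto_const LIMSEQ_inverse_real_of_nat, of I] by simp
  ultimately have "F p \<le> I" by (rule LIMSEQ_le) (use u less_imp_le in blast)
  \<comment> \<open>Quadratic growth at \<open>p\<close>: compare with the midpoint of \<open>p\<close> and \<open>y\<close>.\<close>
  then have "F p + (dist p y)\<^sup>2 / 2 \<le> F y" for y
    using I[of "gcomb (1/2) p y"] mid[of p y] by linarith
  then show ?thesis by (rule that)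
qed

text \<open>The superior limit of weighted means of squared distances to a bounded sequence inherits
  strong convexity from the squared distances.\<close>

lemma limsup_mean_square_minimizer:
  fixes x :: "nat \<Rightarrow> 'a::hadamard_space" and w :: "nat \<Rightarrow> nat \<Rightarrow> real"
  assumes bdd: "bounded (range x)" and w: "\<And>n k. 0 \<le> w n k" and w1: "\<And>n. (\<Sum>k\<le>n. w n k) = 1"
  obtains S p where "\<And>y. limsup (\<lambda>n. ereal (\<Sum>k\<le>n. w n k * (dist y (x k))\<^sup>2)) = ereal (S y)"
    and "\<And>y. S p + (dist p y)\<^sup>2 / 2 \<le> S y"
proof -
  define f where "f = (\<lambda>n y. \<Sum>k\<le>n. w n k * (dist y (x k))\<^sup>2)"
  have mean: "(\<Sum>k\<le>n. w n k * g k) \<le> a * (\<Sum>k\<le>n. w n k * h k) + b * (\<Sum>k\<le>n. w n k * h' k) + c"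
    if "\<And>k. g k \<le> a * h k + b * h' k + c" for n and g h h' :: "nat \<Rightarrow> real" and a b c
  proof -
    have "(\<Sum>k\<le>n. w n k * g k) \<le> (\<Sum>k\<le>n. w n k * (a * h k + b * h' k + c))"
      using that w by (intro sum_mono mult_left_mono)
    also have "\<dots> = a * (\<Sum>k\<le>n. w n k * h k) + b * (\<Sum>k\<le>n. w n k * h' k) + c * (\<Sum>k\<le>n. w n k)"
      by (simp add: sum.distrib sum_distrib_left algebra_simps)
    finally show ?thesis by (simp add: w1)
  qed
  have "\<exists>B. \<forall>k. dist y (x k) \<le> B" for y
    using bdd unfolding bounded_any_center[of _ y] by blast
  then obtain B where B: "\<And>y k. dist y (x k) \<le> B y" by metis
  have f0: "0 \<le> f n y" for n y unfolding f_def using w by (intro sum_nonneg) simp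
  have "f n y \<le> (B y)\<^sup>2" for n y
    unfolding f_def using mean[of "\<lambda>k. (dist y (x k))\<^sup>2" 0 "\<lambda>_. 0" 0 "\<lambda>_. 0" "(B y)\<^sup>2" n]
    by (simp add: B power_mono)
  then have "\<forall>y. \<exists>L. limsup (\<lambda>n. ereal (f n y)) = ereal L"
    using f0 by (metis limsup_real_exists atLeastAtMost_iff)
  then obtain S where S: "\<And>y. limsup (\<lambda>n. ereal (f n y)) = ereal (S y)" by metis
  have S_le: "S y \<le> a * S z + b * S z' + c"
    if "\<And>k. (dist y (x k))\<^sup>2 \<le> a * (dist z (x k))\<^sup>2 + b * (dist z' (x k))\<^sup>2 + c" "0 \<le> a" "0 \<le> b"
    for y z z' a b c
    by (rule limsup_le_combination[OF S S S that(2,3) tendsto_const[of 0]])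
      (use mean[OF that(1)] in \<open>simp add: f_def\<close>)
  have mid: "S (gcomb (1/2) y z) \<le> S y / 2 + S z / 2 - (dist y z)\<^sup>2 / 4" for y z
    using S_le[of "gcomb (1/2) y z" "1/2" y "1/2" z "- ((dist y z)\<^sup>2 / 4)"] CN_inequality[of y z]
    by simp
  have S0: "0 \<le> S y" for y
    using S_le[of y 0 y 0 y 0] le_Limsup[of sequentially "0::ereal" "\<lambda>n. ereal (f n y)"] S f0 by simp
  have lip: "\<bar>S z - S y\<bar> \<le> dist y z * (2 * B y + dist y z)" for y z
  proof -
    have *: "\<bar>(dist z (x k))\<^sup>2 - (dist y (x k))\<^sup>2\<bar> \<le> dist y z * (2 * B y + dist y z)" for k
    proof -
      have 1: "\<bar>dist z (x k) - dist y (x k)\<bar> \<le> dist y z"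
        using dist_triangle[of z "x k" y] dist_triangle[of y "x k" z] by (simp add: dist_commute)
      then have 2: "\<bar>dist z (x k) + dist y (x k)\<bar> \<le> 2 * B y + dist y z" using B[of y k] by simp
      have eq: "(dist z (x k))\<^sup>2 - (dist y (x k))\<^sup>2
          = (dist z (x k) - dist y (x k)) * (dist z (x k) + dist y (x k))"
        by (simp add: power2_eq_square algebra_simps)
      then show ?thesis unfolding eq abs_mult using 1 2 by (intro mult_mono) auto
    qed
    show ?thesis
      using S_le[of z 1 y 0 y "dist y z * (2 * B y + dist y z)"]
        S_le[of y 1 z 0 z "dist y z * (2 * B y + dist y z)"] *
      by (auto simp: abs_le_iff algebra_simps)
  qed
  have "(S \<longlongrightarrow> S y) (at y)" for y
  proof (rule LIM_zero_cancel, rule Lim_null_comparison)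
    show "\<forall>\<^sub>F z in at y. norm (S z - S y) \<le> dist y z * (2 * B y + dist y z)" using lip by simp
    show "((\<lambda>z. dist y z * (2 * B y + dist y z)) \<longlongrightarrow> 0) (at y)"
      by (auto intro!: tendsto_eq_intros)
  qed
  then have "continuous_on UNIV S" by (simp add: continuous_on_eq_continuous_at isCont_def)
  then obtain p where "\<And>y. S p + (dist p y)\<^sup>2 / 2 \<le> S y"
    using strongly_convex_minimizer[of S] S0 mid by blast
  then show ?thesis using that S unfolding f_def by blast
qed

lemma asymptotic_center_bounded:
  fixes x :: "nat \<Rightarrow> 'a::hadamard_space"
  assumes "bounded (range x)"
  obtains S p where "\<And>y. limsup (\<lambda>n. ereal ((dist y (x n))\<^sup>2)) = ereal (S y)"
    and "\<And>y. S p + (dist p y)\<^sup>2 / 2 \<le> S y" and "asymptotic_center x = {p}"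
proof -
  obtain S p where "\<And>y. limsup (\<lambda>n. ereal (\<Sum>k\<le>n. (if k = n then 1 else 0) * (dist y (x k))\<^sup>2)) = ereal (S y)"
    and p: "\<And>y. S p + (dist p y)\<^sup>2 / 2 \<le> S y"
    by (rule limsup_mean_square_minimizer[OF assms, of "\<lambda>n k. if k = n then 1 else 0"]) auto
  moreover have "(\<Sum>k\<le>n. (if k = n then 1 else 0) * g k) = g n" for n and g :: "nat \<Rightarrow> real"
    by (simp add: if_distrib[of "\<lambda>c. c * _"] cong: if_cong)
  ultimately have S: "limsup (\<lambda>n. ereal ((dist y (x n))\<^sup>2)) = ereal (S y)" for y by simp
  have "limsup (\<lambda>n. ereal (dist y (x n))) = ereal (sqrt (S y))" for y
    using limsup_sqrt[OF S[of y]] by simp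
  then have "asymptotic_center x = {z. \<forall>y. S z \<le> S y}"
    by (simp add: asymptotic_center_def)
  also have "\<dots> = {p}"
  proof (intro set_eqI iffI)
    fix z assume "z \<in> {z. \<forall>y. S z \<le> S y}"
    then have "S z \<le> S p" by simp
    with p[of z] have "(dist p z)\<^sup>2 \<le> 0" by linarith
    then show "z \<in> {p}" by simp
  next
    fix z assume "z \<in> {p}"
    moreover have "S p \<le> S y" for y using p[of y] zero_le_power2[of "dist p y"] by linarith
    ultimately show "z \<in> {z. \<forall>y. S z \<le> S y}" by simp
  qed
  finally show ?thesis using that S p by blast
qed

text \<open>An Opial-type principle. Along subsequences the distances to a point of \<open>Z\<close> keep their
  limits, so the asymptotic centers of the sequence and of a subsequence, both in \<open>Z\<close>, minimize the
  same quantity.\<close>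

lemma fejer_monotone_delta_convergent:
  fixes x :: "nat \<Rightarrow> 'a::hadamard_space"
  assumes bdd: "bounded (range x)" and fejer: "\<And>u. u \<in> Z \<Longrightarrow> decseq (\<lambda>n. dist u (x n))"
    and centers: "\<And>r p. \<lbrakk>strict_mono r; asymptotic_center (x \<circ> r) = {p}\<rbrakk> \<Longrightarrow> p \<in> Z"
  shows "\<exists>p\<in>Z. delta_convergent_to x p"
proof -
  have sub: "\<exists>p\<in>Z. asymptotic_center (x \<circ> r) = {p}" if "strict_mono r" for r
  proof -
    have "bounded (range (x \<circ> r))" by (rule bounded_subset[OF bdd]) auto
    then obtain p where "asymptotic_center (x \<circ> r) = {p}" by (rule asymptotic_center_bounded)
    then show ?thesis using centers that by blast
  qed
  obtain p where p: "p \<in> Z" "asymptotic_center x = {p}"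
    using sub[of id] by (auto simp: strict_mono_id)
  have "asymptotic_center (x \<circ> r) = {p}" if r: "strict_mono r" for r
  proof -
    obtain q where q: "q \<in> Z" "asymptotic_center (x \<circ> r) = {q}" using sub r by blast
    have lim: "\<exists>c. limsup (\<lambda>n. ereal (dist u (x n))) = c
        \<and> limsup (\<lambda>n. ereal (dist u ((x \<circ> r) n))) = c" if u: "u \<in> Z" for u
    proof -
      obtain c where c: "(\<lambda>n. dist u (x n)) \<longlonglongrightarrow> c"
        using decseq_convergent[OF fejer[OF u], of 0] by auto
      have "(\<lambda>n. dist u ((x \<circ> r) n)) \<longlonglongrightarrow> c"
        using LIMSEQ_subseq_LIMSEQ[OF c r] by (simp add: o_def)
      with c show ?thesis by (intro exI[of _ "ereal c"] conjI lim_imp_Limsup) simp_all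
    qed
    have "limsup (\<lambda>n. ereal (dist p (x n))) \<le> limsup (\<lambda>n. ereal (dist q (x n)))"
      using p(2) unfolding asymptotic_center_def by blast
    then have "limsup (\<lambda>n. ereal (dist p ((x \<circ> r) n))) \<le> limsup (\<lambda>n. ereal (dist q ((x \<circ> r) n)))"
      using lim[OF p(1)] lim[OF q(1)] by auto
    moreover have "limsup (\<lambda>n. ereal (dist q ((x \<circ> r) n))) \<le> limsup (\<lambda>n. ereal (dist y ((x \<circ> r) n)))" for y
      using q(2) unfolding asymptotic_center_def by blast
    ultimately have "p \<in> asymptotic_center (x \<circ> r)"
      unfolding asymptotic_center_def using order_trans by blast
    then show ?thesis using q(2) by simp
  qed
  then show ?thesis using p(1) unfolding delta_convergent_to_def by blast
qed


section \<open>The proximal point algorithm\<close>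

lemma monotone_qip:
  fixes A :: "'a::cat0_space \<Rightarrow> 'a tangent set"
  assumes "monotone_vector_field A" "0 \<le> a" "0 \<le> b"
    and "tangent_class u a (geod u w) \<in> A u" "tangent_class v b (geod v z) \<in> A v"
  shows "a * qip u w v + b * qip v z u \<le> 0"
proof -
  have "tangent_inner u (tangent_class u a (geod u w)) (tangent_class u 1 (geod u v))
      + tangent_inner v (tangent_class v b (geod v z)) (tangent_class v 1 (geod v u)) \<le> 0"
    using assms unfolding monotone_vector_field_def by blast
  then show ?thesis
    using tangent_inner_class_ge[of a 1 u w v] tangent_inner_class_ge[of b 1 v z u] assms(2,3)
    by simp
qed

lemma tangent_class_resolvent_mem:
  fixes A :: "'a::cat0_space \<Rightarrow> 'a tangent set" and x :: 'a
  assumes mono: "monotone_vector_field A" and surj: "surjectivity_condition A" and l: "0 < l"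
  defines "z \<equiv> resolvent A l x"
  shows "tangent_class z (1 / l) (geod z x) \<in> A z"
proof -
  have "u = v" if "u \<in> resolvent_set A l x" "v \<in> resolvent_set A l x" for u v
  proof -
    have "1 / l * qip u x v + 1 / l * qip v x u \<le> 0"
      using that l by (intro monotone_qip[OF mono]) (simp_all add: resolvent_set_def)
    moreover have "qip u x v + qip v x u = (dist u v)\<^sup>2"
      by (simp add: qip_def dist_commute field_simps)
    then have "1 / l * qip u x v + 1 / l * qip v x u = 1 / l * (dist u v)\<^sup>2"
      by (simp only: distrib_left[symmetric])
    ultimately have "(dist u v)\<^sup>2 \<le> 0" using l by (simp add: divide_le_0_iff)
    then show ?thesis by simp
  qed
  moreover obtain u where "u \<in> resolvent_set A l x"
    using surj l unfolding surjectivity_condition_def resolvent_set_def by blast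
  ultimately have "resolvent_set A l x = {u}" by blast
  then have "z \<in> resolvent_set A l x" by (simp add: z_def resolvent_def)
  then show ?thesis by (simp add: resolvent_set_def)
qed

text \<open>The proximal point sequence of a monotone vector field, with arbitrary positive step sizes.\<close>

locale proximal_point =
  fixes A :: "'a::hadamard_space \<Rightarrow> 'a tangent set" and x :: "nat \<Rightarrow> 'a" and lam :: "nat \<Rightarrow> real"
  assumes mono: "monotone_vector_field A" and surj: "surjectivity_condition A"
    and lam_pos: "\<And>n. 0 < lam n" and x_Suc: "\<And>n. x (Suc n) = resolvent A (lam n) (x n)"
begin

lemma step: "tangent_class (x (Suc n)) (1 / lam n) (geod (x (Suc n)) (x n)) \<in> A (x (Suc n))"
  unfolding x_Suc by (rule tangent_class_resolvent_mem[OF mono surj lam_pos])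

lemma zeros_if_resolvent_fixed:
  assumes "resolvent A 1 p = p"
  shows "p \<in> zeros A"
  using tangent_class_resolvent_mem[OF mono surj, of 1 p] assms
  by (simp add: zeros_def tangent_class_refl)

text \<open>Monotonicity between \<open>x (Suc n)\<close> and the resolvent of an arbitrary point \<open>p\<close>.\<close>

lemma resolvent_inequality:
  defines "q \<equiv> \<lambda>p. resolvent A 1 p"
  shows "(dist (q p) p)\<^sup>2 + (dist (q p) (x (Suc n)))\<^sup>2
    \<le> (dist p (x (Suc n)))\<^sup>2 - 2 / lam n * qip (x (Suc n)) (x n) (q p)"
proof -
  have "1 / lam n * qip (x (Suc n)) (x n) (q p) + 1 * qip (q p) p (x (Suc n)) \<le> 0"
    using tangent_class_resolvent_mem[OF mono surj, of 1 p] step lam_pos[of n]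
    by (intro monotone_qip[OF mono]) (simp_all add: q_def)
  then show ?thesis by (simp add: qip_def[of "q p"] field_simps)
qed

lemma fejer_step:
  assumes "u \<in> zeros A"
  shows "(dist (x (Suc n)) (x n))\<^sup>2 + (dist u (x (Suc n)))\<^sup>2 \<le> (dist u (x n))\<^sup>2"
proof -
  have "1 / lam n * qip (x (Suc n)) (x n) u + 0 * qip u u (x (Suc n)) \<le> 0"
    using assms step lam_pos[of n]
    by (intro monotone_qip[OF mono]) (simp_all add: zeros_def tangent_zero_def)
  then have "qip (x (Suc n)) (x n) u \<le> 0" using lam_pos[of n] by (simp add: divide_le_0_iff)
  then show ?thesis by (simp add: qip_def dist_commute)
qed

lemma decseq_dist_zero:
  assumes "u \<in> zeros A"
  shows "decseq (\<lambda>n. dist u (x n))"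
proof (rule decseq_SucI)
  fix n
  have "(dist u (x (Suc n)))\<^sup>2 \<le> (dist u (x n))\<^sup>2"
    using fejer_step[OF assms, of n] zero_le_power2[of "dist (x (Suc n)) (x n)"] by linarith
  then show "dist u (x (Suc n)) \<le> dist u (x n)" by simp
qed

lemma bounded_if_zeros:
  assumes "zeros A \<noteq> {}"
  shows "bounded (range x)"
proof -
  obtain u where "u \<in> zeros A" using assms by blast
  then have "dist u (x n) \<le> dist u (x 0)" for n using decseq_dist_zero decseqD by blast
  then show ?thesis by (auto simp: bounded_def)
qed

text \<open>The minimizer of the superior limit of the means of squared distances to the sequence, weighted
  by the step sizes, is a fixed point of the resolvent.\<close>

lemma zeros_if_bounded:
  assumes div: "filterlim (\<lambda>N. \<Sum>n<N. lam n) at_top sequentially" and bdd: "bounded (range x)"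
  shows "zeros A \<noteq> {}"
proof -
  define \<sigma> where "\<sigma> = (\<lambda>n. \<Sum>k\<le>n. lam k)"
  have \<sigma>_pos: "0 < \<sigma> n" for n unfolding \<sigma>_def using lam_pos by (intro sum_pos) auto
  have "filterlim (\<lambda>N. \<Sum>n<Suc N. lam n) at_top sequentially"
    using div by (subst filterlim_sequentially_Suc)
  then have \<sigma>_lim: "filterlim \<sigma> at_top sequentially" by (simp add: \<sigma>_def lessThan_Suc_atMost)
  have weights: "0 \<le> lam k / \<sigma> n" "(\<Sum>k\<le>n. lam k / \<sigma> n) = 1" for k n
    using \<sigma>_pos[of n] lam_pos[of k] by (simp_all add: sum_divide_distrib[symmetric]) (simp add: \<sigma>_def)
  have "bounded (range (\<lambda>k. x (Suc k)))" by (rule bounded_subset[OF bdd]) auto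
  then obtain S p where S: "\<And>y. limsup (\<lambda>n. ereal (\<Sum>k\<le>n. lam k / \<sigma> n * (dist y (x (Suc k)))\<^sup>2)) = ereal (S y)"
    and p: "\<And>y. S p + (dist p y)\<^sup>2 / 2 \<le> S y"
    by (rule limsup_mean_square_minimizer[where w = "\<lambda>n k. lam k / \<sigma> n", OF _ weights]) blast
  define q where "q = resolvent A 1 p"
  have step: "lam k * (dist q (x (Suc k)))\<^sup>2 \<le>
      lam k * (dist p (x (Suc k)))\<^sup>2 - lam k * (dist q p)\<^sup>2 + ((dist q (x k))\<^sup>2 - (dist q (x (Suc k)))\<^sup>2)" for k
  proof -
    have "lam k * ((dist q p)\<^sup>2 + (dist q (x (Suc k)))\<^sup>2)
        \<le> lam k * ((dist p (x (Suc k)))\<^sup>2 - 2 / lam k * qip (x (Suc k)) (x k) q)"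
      using resolvent_inequality[of p k] lam_pos[of k] by (intro mult_left_mono) (simp_all add: q_def)
    also have "\<dots> = lam k * (dist p (x (Suc k)))\<^sup>2 - 2 * qip (x (Suc k)) (x k) q"
      using lam_pos[of k] by (simp add: right_diff_distrib)
    also have "\<dots> \<le> lam k * (dist p (x (Suc k)))\<^sup>2 + ((dist q (x k))\<^sup>2 - (dist q (x (Suc k)))\<^sup>2)"
      by (simp add: qip_def dist_commute field_simps)
    finally show ?thesis by (simp add: algebra_simps)
  qed
  \<comment> \<open>Summation telescopes the bracket; the terms with coefficients 1 and 0 are in the shape that the
    passage to superior limits expects.\<close>
  have le: "(\<Sum>k\<le>n. lam k / \<sigma> n * (dist q (x (Suc k)))\<^sup>2) \<le>
      1 * (\<Sum>k\<le>n. lam k / \<sigma> n * (dist p (x (Suc k)))\<^sup>2) + 0 * (\<Sum>k\<le>n. lam k / \<sigma> n * (dist p (x (Suc k)))\<^sup>2)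
      + - (dist q p)\<^sup>2 + (dist q (x 0))\<^sup>2 / \<sigma> n" for n
  proof -
    have telescope: "(\<Sum>k\<le>n. (dist q (x k))\<^sup>2 - (dist q (x (Suc k)))\<^sup>2)
        = (dist q (x 0))\<^sup>2 - (dist q (x (Suc n)))\<^sup>2"
      by (rule sum_telescope)
    have "(\<Sum>k\<le>n. lam k * (dist q (x (Suc k)))\<^sup>2) \<le>
      (\<Sum>k\<le>n. lam k * (dist p (x (Suc k)))\<^sup>2 - lam k * (dist q p)\<^sup>2 + ((dist q (x k))\<^sup>2 - (dist q (x (Suc k)))\<^sup>2))"
      by (intro sum_mono step)
    also have "\<dots> = (\<Sum>k\<le>n. lam k * (dist p (x (Suc k)))\<^sup>2) - \<sigma> n * (dist q p)\<^sup>2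
        + ((dist q (x 0))\<^sup>2 - (dist q (x (Suc n)))\<^sup>2)"
      using telescope by (simp add: sum.distrib sum_subtractf \<sigma>_def sum_distrib_right)
    also have "\<dots> \<le> (\<Sum>k\<le>n. lam k * (dist p (x (Suc k)))\<^sup>2) - \<sigma> n * (dist q p)\<^sup>2 + (dist q (x 0))\<^sup>2"
      by simp
    finally have "(\<Sum>k\<le>n. lam k * (dist q (x (Suc k)))\<^sup>2) / \<sigma> n \<le>
        ((\<Sum>k\<le>n. lam k * (dist p (x (Suc k)))\<^sup>2) - \<sigma> n * (dist q p)\<^sup>2 + (dist q (x 0))\<^sup>2) / \<sigma> n"
      using \<sigma>_pos[of n] by (intro divide_right_mono) simp_all
    then show ?thesis
      using \<sigma>_pos[of n] by (simp add: sum_divide_distrib add_divide_distrib diff_divide_distrib)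
  qed
  have "S q \<le> 1 * S p + 0 * S p + - (dist q p)\<^sup>2"
  proof (rule limsup_le_combination[OF S S S])
    show "(\<lambda>n. (dist q (x 0))\<^sup>2 / \<sigma> n) \<longlonglongrightarrow> 0"
      using \<sigma>_lim filterlim_at_top_imp_at_infinity by (intro tendsto_divide_0[OF tendsto_const])
  qed (use le in simp_all)
  then have "S q \<le> S p - (dist p q)\<^sup>2" by (simp add: dist_commute)
  with p[of q] have "(dist p q)\<^sup>2 \<le> 0" by linarith
  then have "q = p" by simp
  then have "p \<in> zeros A" using zeros_if_resolvent_fixed by (simp add: q_def)
  then show ?thesis by blast
qed

text \<open>The norm of the tangent vector at \<open>x (Suc n)\<close> that the step from \<open>x n\<close> selects from \<open>A\<close>.\<close>

definition slope :: "nat \<Rightarrow> real" where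
  "slope n = dist (x (Suc n)) (x n) / lam n"

text \<open>Monotonicity between consecutive iterates, and the Cauchy-Schwarz inequality.\<close>

lemma decseq_slope: "decseq slope"
proof (rule decseq_SucI)
  fix n
  let ?d = "dist (x (Suc n)) (x n)" and ?e = "dist (x (Suc (Suc n))) (x (Suc n))"
  have "1 / lam n * qip (x (Suc n)) (x n) (x (Suc (Suc n)))
      + 1 / lam (Suc n) * qip (x (Suc (Suc n))) (x (Suc n)) (x (Suc n)) \<le> 0"
    using step lam_pos by (intro monotone_qip[OF mono]) (simp_all add: less_imp_le)
  moreover have "qip (x (Suc (Suc n))) (x (Suc n)) (x (Suc n)) = ?e * ?e"
    by (simp add: qip_def power2_eq_square)
  moreover have "1 / lam n * qip (x (Suc n)) (x n) (x (Suc (Suc n))) \<ge> 1 / lam n * - (?d * ?e)"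
    using abs_qip_le[of "x (Suc n)" "x n" "x (Suc (Suc n))"] lam_pos[of n]
    by (intro mult_left_mono) (auto simp: dist_commute abs_le_iff)
  ultimately have "slope (Suc n) * ?e \<le> slope n * ?e" by (simp add: slope_def)
  moreover have "0 \<le> slope n" "?e = 0 \<Longrightarrow> slope (Suc n) = 0"
    using lam_pos[of n] by (simp_all add: slope_def)
  ultimately show "slope (Suc n) \<le> slope n"
    by (metis mult_right_le_imp_le zero_le_dist order_le_less)
qed

lemma slope_tendsto_0:
  assumes u: "u \<in> zeros A" and div: "filterlim (\<lambda>N. \<Sum>n<N. (lam n)\<^sup>2) at_top sequentially"
  shows "slope \<longlonglongrightarrow> 0"
proof -
  have nonneg: "0 \<le> slope n" for n using lam_pos[of n] by (simp add: slope_def)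
  have small: "\<exists>n. slope n < e" if e: "0 < e" for e
  proof (rule ccontr)
    assume "\<not> ?thesis"
    then have ge: "e \<le> slope n" for n by (simp add: not_less)
    \<comment> \<open>The squares of the step lengths are summable by \<open>fejer_step\<close>, and \<open>e * lam n\<close> is at most the
      length of the step.\<close>
    have "(\<Sum>n<N. (lam n)\<^sup>2) \<le> (dist u (x 0))\<^sup>2 / e\<^sup>2" for N
    proof -
      have "e\<^sup>2 * (lam n)\<^sup>2 \<le> (dist u (x n))\<^sup>2 - (dist u (x (Suc n)))\<^sup>2" for n
      proof -
        have "e * lam n \<le> dist (x (Suc n)) (x n)"
          using ge[of n] lam_pos[of n] by (simp add: slope_def field_simps)
        then have "(e * lam n)\<^sup>2 \<le> (dist (x (Suc n)) (x n))\<^sup>2"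
          using e lam_pos[of n] by (intro power_mono) simp_all
        then show ?thesis using fejer_step[OF u, of n] by (simp add: power_mult_distrib)
      qed
      then have "(\<Sum>n<N. e\<^sup>2 * (lam n)\<^sup>2) \<le> (\<Sum>n<N. (dist u (x n))\<^sup>2 - (dist u (x (Suc n)))\<^sup>2)"
        by (rule sum_mono)
      also have "\<dots> = (dist u (x 0))\<^sup>2 - (dist u (x N))\<^sup>2"
        by (rule sum_lessThan_telescope')
      finally show ?thesis
        using e by (simp add: sum_distrib_left[symmetric] field_simps) (smt (verit) zero_le_power2)
    qed
    moreover have "\<forall>\<^sub>F N in sequentially. (dist u (x 0))\<^sup>2 / e\<^sup>2 < (\<Sum>n<N. (lam n)\<^sup>2)"
      using div by (simp add: filterlim_at_top_dense)
    then obtain N where "(dist u (x 0))\<^sup>2 / e\<^sup>2 < (\<Sum>n<N. (lam n)\<^sup>2)"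
      using eventually_happens trivial_limit_sequentially by blast
    ultimately show False by (simp add: leD)
  qed
  show ?thesis
  proof (rule LIMSEQ_I)
    fix e :: real assume "0 < e"
    then obtain N where "slope N < e" using small by blast
    then have "norm (slope n - 0) < e" if "N \<le> n" for n
      using decseqD[OF decseq_slope that] nonneg[of n] by simp
    then show "\<exists>N. \<forall>n\<ge>N. norm (slope n - 0) < e" by blast
  qed
qed

text \<open>Demiclosedness: passing from \<open>p\<close> to its resolvent does not increase the superior limit of the
  distances, so an asymptotic center is fixed.\<close>

lemma asymptotic_center_zero:
  assumes bdd: "bounded (range x)" and slope: "slope \<longlonglongrightarrow> 0"
    and r: "strict_mono r" and center: "asymptotic_center (x \<circ> r) = {p}"
  shows "p \<in> zeros A"
proof -
  have "bounded (range (x \<circ> r))" by (rule bounded_subset[OF bdd]) auto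
  then obtain S p' where S: "\<And>y. limsup (\<lambda>n. ereal ((dist y ((x \<circ> r) n))\<^sup>2)) = ereal (S y)"
    and p': "\<And>y. S p' + (dist p' y)\<^sup>2 / 2 \<le> S y" "asymptotic_center (x \<circ> r) = {p'}"
    by (rule asymptotic_center_bounded) blast
  have "p' = p" using p'(2) center by simp
  define q where "q = resolvent A 1 p"
  obtain M where M: "\<And>n. dist q (x n) \<le> M" using bdd unfolding bounded_any_center[of _ q] by blast
  have "(dist q (x (Suc n)))\<^sup>2 \<le> (dist p (x (Suc n)))\<^sup>2 + 2 * M * slope n" for n
  proof -
    have "- qip (x (Suc n)) (x n) q \<le> dist (x (Suc n)) (x n) * dist (x (Suc n)) q"
      using abs_qip_le[of "x (Suc n)" "x n" q] by (simp add: abs_le_iff)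
    also have "\<dots> \<le> dist (x (Suc n)) (x n) * M"
      using M by (intro mult_left_mono) (simp_all add: dist_commute)
    finally have "2 / lam n * - qip (x (Suc n)) (x n) q \<le> 2 / lam n * (dist (x (Suc n)) (x n) * M)"
      using lam_pos[of n] by (intro mult_left_mono) simp_all
    then have "- (2 / lam n * qip (x (Suc n)) (x n) q) \<le> 2 * M * slope n"
      by (simp add: slope_def mult_ac)
    then show ?thesis
      using resolvent_inequality[of p n, folded q_def] zero_le_power2[of "dist q p"] by linarith
  qed
  \<comment> \<open>The initial point is not a resolvent, hence the restriction to positive indices.\<close>
  then have le: "(dist q (x n))\<^sup>2 \<le> (dist p (x n))\<^sup>2 + 2 * M * slope (n - 1)" if "0 < n" for n
    using that by (cases n) auto
  have "(\<lambda>n. slope (n - 1)) \<longlonglongrightarrow> 0"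
    by (rule LIMSEQ_imp_Suc) (use slope in simp)
  from LIMSEQ_subseq_LIMSEQ[OF this r]
  have \<epsilon>: "(\<lambda>n. 2 * M * slope (r n - 1)) \<longlonglongrightarrow> 0"
    by (auto simp: o_def intro: tendsto_mult_right_zero)
  have "S q \<le> 1 * S p + 0 * S p + 0"
  proof (rule limsup_le_combination[OF S S S _ _ \<epsilon>])
    have "0 < r n" if "1 \<le> n" for n using seq_suble[OF r, of n] that by linarith
    then show "\<forall>\<^sub>F n in sequentially. (dist q ((x \<circ> r) n))\<^sup>2 \<le> 1 * (dist p ((x \<circ> r) n))\<^sup>2
        + 0 * (dist p ((x \<circ> r) n))\<^sup>2 + 0 + 2 * M * slope (r n - 1)"
      using le by (auto simp: eventually_sequentially)
  qed simp_all
  then have "S q \<le> S p" by simp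
  with p'(1)[of q] have "(dist p q)\<^sup>2 \<le> 0" unfolding \<open>p' = p\<close> by linarith
  then have "q = p" by simp
  then show ?thesis using zeros_if_resolvent_fixed by (simp add: q_def)
qed

end

theorem theorem5p1:
  fixes A :: "'a::hadamard_space \<Rightarrow> 'a tangent set"
    and x :: "nat \<Rightarrow> 'a"
    and lam :: "nat \<Rightarrow> real"
  assumes "monotone_vector_field A"
    and "surjectivity_condition A"
    and "\<And>n. lam n > 0"
    and "\<And>n. x (Suc n) = resolvent A (lam n) (x n)"
  shows "(filterlim (\<lambda>N. \<Sum>n<N. lam n) at_top sequentially \<longrightarrow>
            (bounded (range x) \<longleftrightarrow> zeros A \<noteq> {})) \<and>
         (zeros A \<noteq> {} \<and> filterlim (\<lambda>N. \<Sum>n<N. (lam n)\<^sup>2) at_top sequentially \<longrightarrow>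
            (\<exists>p\<in>zeros A. delta_convergent_to x p))"
proof -
  interpret proximal_point A x lam using assms by unfold_locales
  have "\<exists>p\<in>zeros A. delta_convergent_to x p"
    if "zeros A \<noteq> {}" and div: "filterlim (\<lambda>N. \<Sum>n<N. (lam n)\<^sup>2) at_top sequentially"
  proof -
    obtain u where u: "u \<in> zeros A" using \<open>zeros A \<noteq> {}\<close> by blast
    have bdd: "bounded (range x)" using \<open>zeros A \<noteq> {}\<close> by (rule bounded_if_zeros)
    show ?thesis
      using bdd decseq_dist_zero asymptotic_center_zero[OF bdd slope_tendsto_0[OF u div]]
      by (rule fejer_monotone_delta_convergent)
  qed
  then show ?thesis using bounded_if_zeros zeros_if_bounded by blast
qed

end
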